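(* For $n\ge1$ let $\widehat{B}_n(x,y)=\sum_{\sigma\in\mathcal{B}_n}x^{\mathrm{des}_1\sigma}y^{\mathrm{asc}_0\sigma}$ and let $\alpha=(1-x)(1-y)$. Then $$\sum_{n\geq 1}\widehat{B}_{2n}(x,y)\frac{t^{2n}}{(2n)!}=\frac{(1+xy)\sum_{n\geq 0}\frac{(-\alpha)^n (2t)^{2n}}{(2n)!}+\sum_{n\geq 0}\frac{(-\alpha)^{n+1} t^{2n}}{(2n)!}-(x+y)}{(x+y)-(1+xy)\sum_{n\geq 0}\frac{(-\alpha)^n (2t)^{2n}}{(2n)!}}$$ and $$\sum_{n\geq 1}\widehat{B}_{2n-1}(x,y)\frac{t^{2n-1}}{(2n-1)!}=\frac{(1+y)\,\sum_{n\geq 0}\frac{(-\alpha)^{n+1} t^{2n+1}}{(2n+1)!}}{(x+y)-(1+xy)\sum_{n\geq 0}\frac{(-\alpha)^n (2t)^{2n}}{(2n)!}}.$$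
   Context: $\mathcal{B}_n$ is the set of signed permutations, i.e. bijections $\sigma$ of $\{\pm1,\dots,\pm n\}$ with $\sigma(-i)=-\sigma(i)$; each $\sigma$ is identified with the word $\sigma(0)\sigma(1)\cdots\sigma(n)$ where $\sigma(0)=0$. A position $i\in\{0,1,\dots,n-1\}$ is a descent if $\sigma(i)>\sigma(i+1)$ and an ascent if $\sigma(i)<\sigma(i+1)$. $\mathrm{des}_1\sigma$ is the number of descents at odd positions and $\mathrm{asc}_0\sigma$ the number of ascents at even positions (including position $0$). *)

theory Defs
  imports
    "HOL-Combinatorics.Permutations"
    "HOL-Computational_Algebra.Computational_Algebra"
begin

text \<open>
  A signed permutation is a function on all integers that is the identity outside
  $\{\pm 1,\dots,\pm n\}$, so that distinct signed permutations are distinct functions and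
  the convention $\sigma(0)=0$ holds automatically.
\<close>
definition signed_perms :: "nat \<Rightarrow> (int \<Rightarrow> int) set" where
  "signed_perms n = {\<sigma>. \<sigma> permutes ({- int n..int n} - {0}) \<and> (\<forall>i. \<sigma> (- i) = - \<sigma> i)}"

definition descents :: "nat \<Rightarrow> (int \<Rightarrow> int) \<Rightarrow> nat set" where
  "descents n \<sigma> = {i. i < n \<and> \<sigma> (int i) > \<sigma> (int (i + 1))}"

definition ascents :: "nat \<Rightarrow> (int \<Rightarrow> int) \<Rightarrow> nat set" where
  "ascents n \<sigma> = {i. i < n \<and> \<sigma> (int i) < \<sigma> (int (i + 1))}"

definition des1 :: "nat \<Rightarrow> (int \<Rightarrow> int) \<Rightarrow> nat" where
  "des1 n \<sigma> = card {i \<in> descents n \<sigma>. odd i}"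

definition asc0 :: "nat \<Rightarrow> (int \<Rightarrow> int) \<Rightarrow> nat" where
  "asc0 n \<sigma> = card {i \<in> ascents n \<sigma>. even i}"

definition Bhat :: "nat \<Rightarrow> 'a::comm_semiring_1 \<Rightarrow> 'a \<Rightarrow> 'a" where
  "Bhat n x y = (\<Sum>\<sigma>\<in>signed_perms n. x ^ des1 n \<sigma> * y ^ asc0 n \<sigma>)"

text \<open>
  The generating functions are formal power series in $t$ over the field $\mathbb{Q}(x,y)$,
  realised as the fraction field of $\mathbb{Z}[x][y]$. The denominators in the generating
  function identities have constant term $-(1-x)(1-y)$, which is a unit in this field but
  not in $\mathbb{Z}[x,y]$.
\<close>
type_synonym ratfun = "int poly poly fract"

definition indet_x :: ratfun where
  "indet_x = to_fract [:[:0, 1:]:]"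

definition indet_y :: ratfun where
  "indet_y = to_fract [:0, 1:]"

end

theory Submission
  imports Defs
begin

text \<open>
  At each position the weight is split as an unmarked weight (\<open>1\<close> at even, \<open>x\<close> at odd positions)
  plus a marked weight (\<open>y - 1\<close> at even, \<open>1 - x\<close> at odd positions) that only counts at ascents.
  Expanding the product from the right end, the marked positions cut out a last maximal increasing
  block. If the block avoids the leading \<open>0\<close> and uses the absolute values in \<open>U\<close>, it can be
  chosen in \<open>2 ^ card U\<close> ways, and the rest is a signed word on the remaining absolute values; if it
  contains the leading \<open>0\<close>, all its entries are positive and it is unique. Working with words over
  arbitrary finite sets of positive integers, this recurrence shows by itself that the weighted count
  depends only on the size of the set, so no standardisation is needed.

  With \<open>c = (y - 1) * (1 - x)\<close>, the recurrence is a linear system for the even and odd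
  parts of the exponential generating function whose coefficients are the series
  \<open>cosh (r * sqrt c * t)\<close> and \<open>sinh (r * sqrt c * t) / sqrt c\<close> for \<open>r = 1, 2\<close>. Its determinant
  simplifies by \<open>cosh\<^sup>2 - sinh\<^sup>2 = 1\<close>, the right-hand sides by the subtraction formulas.
\<close>

subsection \<open>Signed words with an increasing tail\<close>

definition unmarked_weight :: "'a \<Rightarrow> nat \<Rightarrow> 'a::comm_ring_1" where
  "unmarked_weight x i = (if even i then 1 else x)"

definition marked_weight :: "'a \<Rightarrow> 'a \<Rightarrow> nat \<Rightarrow> 'a::comm_ring_1" where
  "marked_weight x y i = (if even i then y - 1 else 1 - x)"

definition signed_words :: "int set \<Rightarrow> int list set" where
  "signed_words S = {w. distinct (map abs w) \<and> abs ` set w = S}"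

text \<open>
  Position \<open>i\<close> of the word \<open>0 # w\<close> compares its entry \<open>i\<close> with \<open>w ! i\<close>. An ascent contributes
  \<open>y\<close> if \<open>i\<close> is even and \<open>1\<close> if \<open>i\<close> is odd; a descent contributes \<open>1\<close> and \<open>x\<close>, respectively.
\<close>
definition step_weight :: "'a \<Rightarrow> 'a \<Rightarrow> int list \<Rightarrow> nat \<Rightarrow> 'a::comm_ring_1" where
  "step_weight x y w i = unmarked_weight x i +
     (if (0 # w) ! i < w ! i then marked_weight x y i else 0)"

definition prefix_weight :: "'a \<Rightarrow> 'a \<Rightarrow> nat \<Rightarrow> int list \<Rightarrow> 'a::comm_ring_1" where
  "prefix_weight x y k w = (\<Prod>i<k. step_weight x y w i)"

definition words_sum :: "'a \<Rightarrow> 'a \<Rightarrow> int set \<Rightarrow> 'a::comm_ring_1" where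
  "words_sum x y S = (\<Sum>w\<in>signed_words S. prefix_weight x y (card S) w)"

definition increasing_words :: "int set \<Rightarrow> int list set" where
  "increasing_words S = {w \<in> signed_words S. sorted_wrt (<) w}"

text \<open>Only positions below \<open>k\<close> are weighed; all positions from \<open>k\<close>
  on must be ascents. As \<open>k\<close> runs from \<open>0\<close> to \<open>card S\<close>, this
  passes from the fully increasing word to no restriction at all.\<close>

definition increasing_tail_sum :: "'a \<Rightarrow> 'a \<Rightarrow> int set \<Rightarrow> nat \<Rightarrow> 'a::comm_ring_1" where
  "increasing_tail_sum x y S k =
     (\<Sum>w | w \<in> signed_words S \<and> sorted_wrt (<) (drop k (0 # w)). prefix_weight x y k w)"

section \<open>Basic facts on signed words; counting the increasing ones\<close>

lemma length_signed_word: "w \<in> signed_words S \<Longrightarrow> length w = card S"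
  by (metis (mono_tags, lifting) signed_words_def mem_Collect_eq distinct_card length_map set_map)

lemma finite_signed_words: "finite S \<Longrightarrow> finite (signed_words S)"
proof -
  assume S: "finite S"
  have "signed_words S \<subseteq> {w. set w \<subseteq> S \<union> uminus ` S \<and> length w = card S}"
  proof
    fix w assume w: "w \<in> signed_words S"
    have "set w \<subseteq> S \<union> uminus ` S"
    proof
      fix z assume "z \<in> set w"
      then have "\<bar>z\<bar> \<in> S" using w by (auto simp: signed_words_def)
      then show "z \<in> S \<union> uminus ` S" by (cases "z \<ge> 0") (auto intro: rev_image_eqI)
    qed
    then show "w \<in> {w. set w \<subseteq> S \<union> uminus ` S \<and> length w = card S}"
      using length_signed_word[OF w] by simp
  qed
  then show ?thesis
    by (rule finite_subset) (intro finite_lists_length_eq finite_UnI finite_imageI S)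
qed

lemma signed_words_append_iff:
  "v @ z \<in> signed_words S \<longleftrightarrow>
     (\<exists>T\<subseteq>S. v \<in> signed_words T \<and> z \<in> signed_words (S - T))"
  by (auto simp: signed_words_def image_Un)

text \<open>An increasing word is determined by its set of entries, hence by the subset of
  \<open>S\<close> that occurs with positive sign, and every subset arises.\<close>

lemma card_increasing_words:
  assumes "finite S" "\<And>s. s \<in> S \<Longrightarrow> s > 0"
  shows "card (increasing_words S) = 2 ^ card S"
proof -
  define g where "g P = sorted_list_of_set (P \<union> uminus ` (S - P))" for P
  have fin: "finite (P \<union> uminus ` (S - P))" if "P \<subseteq> S" for P
    using that assms(1) finite_subset by auto
  have "bij_betw g (Pow S) (increasing_words S)"
  proof (rule bij_betw_byWitness[where f' = "\<lambda>w. set w \<inter> S"])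
    show "\<forall>P\<in>Pow S. set (g P) \<inter> S = P"
    proof
      fix P assume P: "P \<in> Pow S"
      \<comment> \<open>Negated entries are negative while \<open>S\<close> is positive, so
        intersecting with \<open>S\<close> recovers \<open>P\<close>.\<close>
      have "uminus ` (S - P) \<inter> S = {}"
      proof (rule ccontr)
        assume "uminus ` (S - P) \<inter> S \<noteq> {}"
        then obtain s where "s \<in> S" "- s \<in> S" by auto
        then show False using assms(2)[of s] assms(2)[of "- s"] by simp
      qed
      then show "set (g P) \<inter> S = P" using P fin[of P] by (auto simp: g_def)
    qed
    show "\<forall>w\<in>increasing_words S. g (set w \<inter> S) = w"
    proof
      fix w assume w: "w \<in> increasing_words S"
      then have d: "inj_on abs (set w)" and im: "abs ` set w = S" and so: "sorted_wrt (<) w"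
        by (auto simp: increasing_words_def signed_words_def distinct_map)
      have "set w \<inter> S \<union> uminus ` (S - set w \<inter> S) = set w"
      proof (intro equalityI subsetI)
        fix z assume "z \<in> set w \<inter> S \<union> uminus ` (S - set w \<inter> S)"
        then show "z \<in> set w"
        proof
          assume "z \<in> uminus ` (S - set w \<inter> S)"
          then obtain s where s: "z = - s" "s \<in> S" "s \<notin> set w" by auto
          then obtain r where "r \<in> set w" "s = \<bar>r\<bar>" using im by auto
          then show "z \<in> set w" using s by (cases "r \<ge> 0") auto
        qed simp
      next
        fix z assume z: "z \<in> set w"
        then have zS: "\<bar>z\<bar> \<in> S" using im by auto
        show "z \<in> set w \<inter> S \<union> uminus ` (S - set w \<inter> S)"
        proof (cases "z > 0")
          case True then show ?thesis using z zS by auto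
        next
          case False
          with zS assms(2)[of "\<bar>z\<bar>"] have "z < 0" by auto
          \<comment> \<open>Both would have the same absolute value, which a signed word uses only
            once.\<close>
          moreover have "- z \<notin> set w"
            using inj_onD[OF d, of "z" "- z"] z \<open>z < 0\<close> by auto
          ultimately show ?thesis using zS by (auto intro!: image_eqI[of _ _ "- z"])
        qed
      qed
      then show "g (set w \<inter> S) = w"
        unfolding g_def using so
        by (metis List.finite_set sorted_list_of_set.idem_if_sorted_distinct strict_sorted_iff)
    qed
    show "g ` Pow S \<subseteq> increasing_words S"
    proof
      fix w assume "w \<in> g ` Pow S"
      then obtain P where P: "P \<subseteq> S" "w = g P" by auto
      have sw: "set w = P \<union> uminus ` (S - P)" using fin[OF P(1)] P(2) by (simp add: g_def)
      have so: "sorted_wrt (<) w" by (simp add: P(2) g_def)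
      have "abs ` (P \<union> uminus ` (S - P)) = S"
      proof -
        have "abs ` P = P" "abs ` uminus ` (S - P) = S - P"
          using assms(2) P(1) by (force simp: image_iff)+
        then show ?thesis using P(1) by (auto simp: image_Un)
      qed
      moreover have "inj_on abs (P \<union> uminus ` (S - P))"
        using assms(2) P(1) by (force simp: inj_on_def abs_if)
      ultimately show "w \<in> increasing_words S"
        using so sw by (auto simp: increasing_words_def signed_words_def distinct_map strict_sorted_iff)
    qed
  qed auto
  then show ?thesis
    using assms(1) by (metis bij_betw_same_card card_Pow)
qed

section \<open>Growing the increasing tail from right to left\<close>

text \<open>The leading \<open>0\<close> belongs to the tail and forces every entry to be positive,
  leaving only the sorted list of \<open>S\<close>; its weight is an empty product.\<close>

lemma increasing_tail_sum_0:
  assumes "finite S" "\<And>s. s \<in> S \<Longrightarrow> s > 0"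
  shows "increasing_tail_sum x y S 0 = 1"
proof -
  have "{w \<in> signed_words S. sorted_wrt (<) (drop 0 (0 # w))} = {sorted_list_of_set S}" (is "?A = _")
  proof (intro equalityI subsetI)
    fix w assume "w \<in> ?A"
    then have w: "abs ` set w = S" "\<forall>z\<in>set w. 0 < z" "sorted_wrt (<) w"
      by (auto simp: signed_words_def)
    then have "set w = S" by force
    then show "w \<in> {sorted_list_of_set S}" using w(3)
      by (metis singletonI sorted_list_of_set.idem_if_sorted_distinct strict_sorted_iff)
  next
    have "abs ` S = S" "inj_on abs S" using assms(2) by (force simp: inj_on_def abs_if)+
    moreover fix w assume "w \<in> {sorted_list_of_set S}"
    ultimately show "w \<in> ?A" using assms by (auto simp: signed_words_def distinct_map)
  qed
  then show ?thesis by (simp add: increasing_tail_sum_def prefix_weight_def)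
qed

text \<open>After dropping, a single entry remains, so the tail condition is vacuous.\<close>

lemma increasing_tail_sum_card: "increasing_tail_sum x y S (card S) = words_sum x y S"
proof -
  have "sorted_wrt (<) (drop (card S) (0 # w))" if "w \<in> signed_words S" for w
  proof -
    have "length (drop (card S) (0 # w)) = Suc 0" using length_signed_word[OF that] by simp
    then show ?thesis by (metis length_0_conv length_Suc_conv sorted_wrt1)
  qed
  then have "{w \<in> signed_words S. sorted_wrt (<) (drop (card S) (0 # w))} = signed_words S" by auto
  then show ?thesis by (simp add: increasing_tail_sum_def words_sum_def)
qed

text \<open>Here the tail is \<open>drop k w\<close>, with no comparison across position
  \<open>k\<close>. Prefix and tail are therefore independent: the prefix is any signed word on a
  \<open>k\<close>-subset \<open>T\<close>, the tail any increasing word on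
  \<open>S - T\<close>.\<close>

lemma sum_prefix_weight_increasing_tail:
  assumes "finite S" "\<And>s. s \<in> S \<Longrightarrow> s > 0" "k \<le> card S"
  shows "(\<Sum>w | w \<in> signed_words S \<and> sorted_wrt (<) (drop k w). prefix_weight x y k w) =
    2 ^ (card S - k) * (\<Sum>T | T \<subseteq> S \<and> card T = k. words_sum x y T)"
proof -
  let ?I = "{T. T \<subseteq> S \<and> card T = k}"
  let ?J = "SIGMA T:?I. signed_words T \<times> increasing_words (S - T)"
  have fin: "finite T" if "T \<subseteq> S" for T using that assms(1) finite_subset by auto
  have finI: "finite ?I" using assms(1) by simp
  have "(\<Sum>w | w \<in> signed_words S \<and> sorted_wrt (<) (drop k w). prefix_weight x y k w) =
      (\<Sum>(T, v, z)\<in>?J. prefix_weight x y k v)"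
  proof (rule sum.reindex_bij_witness[where i = "\<lambda>(T, v, z). v @ z"
        and j = "\<lambda>w. (abs ` set (take k w), take k w, drop k w)"])
    fix w assume "w \<in> {w \<in> signed_words S. sorted_wrt (<) (drop k w)}"
    then have w: "w \<in> signed_words S" "sorted_wrt (<) (drop k w)" by auto
    have "take k w @ drop k w \<in> signed_words S" using w by simp
    then obtain T where T: "T \<subseteq> S" "take k w \<in> signed_words T" "drop k w \<in> signed_words (S - T)"
      unfolding signed_words_append_iff by blast
    have Teq: "T = abs ` set (take k w)" using T by (simp add: signed_words_def)
    have "card T = k" using length_signed_word[OF T(2)] length_signed_word[OF w(1)] assms(3) by simp
    then show "(abs ` set (take k w), take k w, drop k w) \<in> ?J"
      using T w(2) unfolding Teq[symmetric] by (auto simp: increasing_words_def)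
    show "(case (abs ` set (take k w), take k w, drop k w) of (T, v, z) \<Rightarrow> v @ z) = w" by simp
    \<comment> \<open>Position \<open>i\<close> looks at no entry of \<open>w\<close> beyond index
      \<open>i\<close>, so positions below \<open>k\<close> see only
      \<open>take k w\<close>.\<close>
    have "prefix_weight x y k (take k w) = prefix_weight x y k w"
      unfolding prefix_weight_def step_weight_def by (intro prod.cong) (auto simp: nth_Cons')
    then show "(case (abs ` set (take k w), take k w, drop k w) of (T, v, z) \<Rightarrow> prefix_weight x y k v)
      = prefix_weight x y k w" by simp
  next
    fix p assume "p \<in> ?J"
    then obtain T v z where p: "p = (T, v, z)" and T: "T \<subseteq> S" "card T = k"
      and v: "v \<in> signed_words T" and z: "z \<in> increasing_words (S - T)" by auto
    have l: "length v = k" using length_signed_word[OF v] T by simp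
    show "(case p of (T, v, z) \<Rightarrow> v @ z) \<in> {w \<in> signed_words S. sorted_wrt (<) (drop k w)}"
      using p T v z l signed_words_append_iff[of v z S] by (auto simp: increasing_words_def)
    show "(abs ` set (take k (case p of (T, v, z) \<Rightarrow> v @ z)), take k (case p of (T, v, z) \<Rightarrow> v @ z),
        drop k (case p of (T, v, z) \<Rightarrow> v @ z)) = p"
      using p l v by (simp add: signed_words_def)
  qed
  also have "\<dots> = (\<Sum>T\<in>?I. \<Sum>(v, z)\<in>signed_words T \<times> increasing_words (S - T). prefix_weight x y k v)"
    using assms(1) fin by (subst sum.Sigma) (auto simp: finI increasing_words_def finite_signed_words)
  also have "\<dots> = (\<Sum>T\<in>?I. 2 ^ (card S - k) * words_sum x y T)"
  proof (intro sum.cong refl)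
    fix T assume T: "T \<in> ?I"
    have "card (increasing_words (S - T)) = 2 ^ card (S - T)"
      using assms by (intro card_increasing_words) auto
    also have "card (S - T) = card S - k" using T fin by (simp add: card_Diff_subset)
    finally show "(\<Sum>(v, z)\<in>signed_words T \<times> increasing_words (S - T). prefix_weight x y k v)
        = 2 ^ (card S - k) * words_sum x y T"
      using T by (simp add: sum.cartesian_product[symmetric] words_sum_def sum_distrib_left)
  qed
  finally show ?thesis by (simp add: sum_distrib_left)
qed

text \<open>The ascent condition at position \<open>k\<close> extends the increasing tail one step to the left.\<close>
lemma increasing_tail_sum_Suc:
  assumes "finite S" "\<And>s. s \<in> S \<Longrightarrow> s > 0" "k < card S"
  shows "increasing_tail_sum x y S (Suc k) =
    unmarked_weight x k * (2 ^ (card S - k) * (\<Sum>T | T \<subseteq> S \<and> card T = k. words_sum x y T)) +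
    marked_weight x y k * increasing_tail_sum x y S k"
proof -
  let ?A = "{w \<in> signed_words S. sorted_wrt (<) (drop k w)}"
  let ?P = "\<lambda>w. (0 # w) ! k < w ! k"
  have finA: "finite ?A" using finite_signed_words[OF assms(1)] by simp
  have drop: "sorted_wrt (<) (drop k (0 # w)) \<longleftrightarrow> ?P w \<and> sorted_wrt (<) (drop k w)"
    if "w \<in> signed_words S" for w
  proof -
    have l: "k < length w" using length_signed_word[OF that] assms(3) by simp
    have "drop k (0 # w) = (0 # w) ! k # drop k w"
      using Cons_nth_drop_Suc[of k "0 # w"] l by simp
    moreover have "drop k w = w ! k # drop (Suc k) w"
      using Cons_nth_drop_Suc[OF l] by simp
    ultimately show ?thesis by (metis sorted_wrt2 transp_on_less)
  qed
  have "increasing_tail_sum x y S (Suc k) =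
      (\<Sum>w\<in>?A. prefix_weight x y k w * unmarked_weight x k +
         (if ?P w then marked_weight x y k * prefix_weight x y k w else 0))"
    \<comment> \<open>Since \<open>drop (Suc k) (0 # w)\<close> is \<open>drop k w\<close>, the
      range is \<open>?A\<close>; the last factor of the weight is split into its unmarked and
      marked parts.\<close>
    unfolding increasing_tail_sum_def
    by (intro sum.cong) (auto simp: prefix_weight_def step_weight_def algebra_simps)
  also have "\<dots> = unmarked_weight x k * (\<Sum>w\<in>?A. prefix_weight x y k w) +
      marked_weight x y k * (\<Sum>w | w \<in> ?A \<and> ?P w. prefix_weight x y k w)"
    using finA by (simp add: sum.distrib sum.inter_filter[symmetric] sum_distrib_left mult.commute)
  also have "{w. w \<in> ?A \<and> ?P w} = {w \<in> signed_words S. sorted_wrt (<) (drop k (0 # w))}"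
    using drop by auto
  also have "(\<Sum>w\<in>?A. prefix_weight x y k w) =
      2 ^ (card S - k) * (\<Sum>T | T \<subseteq> S \<and> card T = k. words_sum x y T)"
    using assms by (intro sum_prefix_weight_increasing_tail) auto
  finally show ?thesis by (simp add: increasing_tail_sum_def)
qed

text \<open>This unrolls the one-step recursion. In the term for \<open>j\<close>, position
  \<open>j\<close> is the last one taking its unmarked weight; the leading product is the case where
  all positions are marked.\<close>

lemma increasing_tail_sum_expand:
  assumes "finite S" "\<And>s. s \<in> S \<Longrightarrow> s > 0" "k \<le> card S"
  shows "increasing_tail_sum x y S k = (\<Prod>i<k. marked_weight x y i) +
    (\<Sum>j<k. unmarked_weight x j * (2 ^ (card S - j) *
       (\<Sum>T | T \<subseteq> S \<and> card T = j. words_sum x y T)) * (\<Prod>i=Suc j..<k. marked_weight x y i))"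
  using assms(3)
proof (induction k)
  case 0
  then show ?case using increasing_tail_sum_0[OF assms(1,2)] by simp
next
  case (Suc k)
  have "(\<Prod>i=Suc j..<Suc k. marked_weight x y i) =
      marked_weight x y k * (\<Prod>i=Suc j..<k. marked_weight x y i)" if "j < k" for j
    using that by (simp add: mult.commute)
  then show ?case
    using Suc increasing_tail_sum_Suc[OF assms(1,2), of k x y]
    by (simp add: sum_distrib_left algebra_simps)
qed

section \<open>Recurrence depending only on the number of letters\<close>

definition words_poly :: "'a \<Rightarrow> 'a \<Rightarrow> nat \<Rightarrow> 'a::comm_ring_1" where
  "words_poly x y n = words_sum x y {1..int n}"

text \<open>Take \<open>k = card S\<close> in the expansion. The inner sums run over proper subsets
  of one size, all with the same value by hypothesis, which yields the binomial coefficient.\<close>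

lemma words_sum_recurrence:
  assumes "finite S" "\<And>s. s \<in> S \<Longrightarrow> s > 0"
    and "\<And>T. T \<subset> S \<Longrightarrow> words_sum x y T = words_poly x y (card T)"
  shows "words_sum x y S = (\<Prod>i<card S. marked_weight x y i) +
    (\<Sum>j<card S. unmarked_weight x j * (2 ^ (card S - j) * of_nat (card S choose j) *
       words_poly x y j) * (\<Prod>i=Suc j..<card S. marked_weight x y i))"
proof -
  have "(\<Sum>T | T \<subseteq> S \<and> card T = j. words_sum x y T) = of_nat (card S choose j) * words_poly x y j"
    if "j < card S" for j
  proof -
    have "(\<Sum>T | T \<subseteq> S \<and> card T = j. words_sum x y T) =
        (\<Sum>T | T \<subseteq> S \<and> card T = j. words_poly x y j)"
      using that assms(3) by (intro sum.cong) auto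
    then show ?thesis using n_subsets[OF assms(1)] by simp
  qed
  moreover have "words_sum x y S = increasing_tail_sum x y S (card S)"
    by (simp add: increasing_tail_sum_card)
  ultimately show ?thesis
    by (simp add: increasing_tail_sum_expand[OF assms(1,2)] mult.assoc)
qed

text \<open>Strong induction on the size: once smaller sets are settled, the right-hand side of the
  recurrence mentions \<open>S\<close> only through \<open>card S\<close>.\<close>

lemma words_sum_eq_words_poly:
  assumes "finite S" "\<And>s. s \<in> S \<Longrightarrow> s > 0"
  shows "words_sum x y S = words_poly x y (card S)"
  using assms
proof (induction "card S" arbitrary: S rule: less_induct)
  case less
  \<comment> \<open>Stated for every \<open>S'\<close> of this size, so that it covers both
    \<open>S\<close> and the initial segment \<open>{1..int (card S)}\<close>.\<close>
  have rec: "words_sum x y S' = (\<Prod>i<card S. marked_weight x y i) +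
      (\<Sum>j<card S. unmarked_weight x j * (2 ^ (card S - j) * of_nat (card S choose j) *
         words_poly x y j) * (\<Prod>i=Suc j..<card S. marked_weight x y i))"
    if S': "finite S'" "card S' = card S" "\<And>s. s \<in> S' \<Longrightarrow> s > 0" for S'
  proof -
    have sub: "words_sum x y T = words_poly x y (card T)" if "T \<subset> S'" for T
    proof (rule less.hyps)
      show "card T < card S" using psubset_card_mono[OF S'(1) that] S'(2) by simp
      show "finite T" using that S'(1) finite_subset[of T S'] by auto
    qed (use that S'(3) in auto)
    show ?thesis using words_sum_recurrence[OF S'(1,3) sub] unfolding S'(2) .
  qed
  have "words_sum x y {1..int (card S)} = words_sum x y S"
  proof (rule trans)
    show "words_sum x y {1..int (card S)} = (\<Prod>i<card S. marked_weight x y i) +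
      (\<Sum>j<card S. unmarked_weight x j * (2 ^ (card S - j) * of_nat (card S choose j) *
         words_poly x y j) * (\<Prod>i=Suc j..<card S. marked_weight x y i))"
      by (rule rec) auto
    show "\<dots> = words_sum x y S"
      by (rule rec[symmetric]) (use less.prems in auto)
  qed
  then show ?case by (simp add: words_poly_def)
qed

lemma words_poly_recurrence:
  "words_poly x y n = (\<Prod>i<n. marked_weight x y i) +
    (\<Sum>j<n. unmarked_weight x j * (2 ^ (n - j) * of_nat (n choose j) *
       words_poly x y j) * (\<Prod>i=Suc j..<n. marked_weight x y i))"
proof -
  have sub: "words_sum x y T = words_poly x y (card T)" if "T \<subset> {1..int n}" for T
  proof (rule words_sum_eq_words_poly)
    show "finite T" using that finite_subset[of T "{1..int n}"] by auto
  qed (use that in auto)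
  have "words_sum x y {1..int n} = (\<Prod>i<n. marked_weight x y i) +
    (\<Sum>j<n. unmarked_weight x j * (2 ^ (n - j) * of_nat (n choose j) *
       words_poly x y j) * (\<Prod>i=Suc j..<n. marked_weight x y i))"
    using words_sum_recurrence[where S = "{1..int n}", OF _ _ sub] by simp
  then show ?thesis unfolding words_poly_def[of x y n] .
qed

subsection \<open>Signed permutations as words\<close>

lemma bij_betw_signed_perms_signed_words:
  "bij_betw (\<lambda>\<sigma>. map (\<lambda>i. \<sigma> (int i)) [1..<Suc n]) (signed_perms n) (signed_words {1..int n})"
proof -
  define f :: "(int \<Rightarrow> int) \<Rightarrow> int list" where "f \<sigma> = map (\<lambda>i. \<sigma> (int i)) [1..<Suc n]" for \<sigma>
  \<comment> \<open>The inverse extends a word to an odd function, fixing \<open>0\<close> and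
    everything outside the range; the index is shifted by one because lists start at
    \<open>0\<close>.\<close>
  define g :: "int list \<Rightarrow> int \<Rightarrow> int" where
    "g w i = (if 1 \<le> \<bar>i\<bar> \<and> \<bar>i\<bar> \<le> int n then sgn i * w ! (nat \<bar>i\<bar> - 1) else i)" for w i
  let ?A = "{- int n..int n} - {0}"
  have f_nth: "f \<sigma> ! k = \<sigma> (int (Suc k))" if "k < n" for \<sigma> k
    using that by (simp add: f_def del: upt_Suc)
  have f_length: "length (f \<sigma>) = n" for \<sigma> by (simp add: f_def)
  have "bij_betw f (signed_perms n) (signed_words {1..int n})"
  proof (rule bij_betw_byWitness[where f' = g])
    show "\<forall>\<sigma>\<in>signed_perms n. g (f \<sigma>) = \<sigma>"
    proof (intro ballI ext)
      fix \<sigma> i assume "\<sigma> \<in> signed_perms n"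
      then have p: "\<sigma> permutes ?A" and odd: "\<And>i. \<sigma> (- i) = - \<sigma> i" by (auto simp: signed_perms_def)
      show "g (f \<sigma>) i = \<sigma> i"
      proof (cases "1 \<le> \<bar>i\<bar> \<and> \<bar>i\<bar> \<le> int n")
        case True
        then have "f \<sigma> ! (nat \<bar>i\<bar> - 1) = \<sigma> \<bar>i\<bar>" by (subst f_nth) auto
        then show ?thesis using True odd[of i] by (cases "i > 0") (auto simp: g_def sgn_if)
      next
        case False
        then have "i \<notin> ?A" by auto
        then show ?thesis using False p by (auto simp: g_def permutes_not_in)
      qed
    qed
    show "\<forall>w\<in>signed_words {1..int n}. f (g w) = w"
    proof
      fix w assume "w \<in> signed_words {1..int n}"
      then have "length w = n" using length_signed_word by fastforce
      then show "f (g w) = w"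
        by (intro nth_equalityI) (auto simp: f_length f_nth g_def sgn_if nat_add_distrib)
    qed
    show "f ` signed_perms n \<subseteq> signed_words {1..int n}"
    proof (intro image_subsetI)
      fix \<sigma> assume "\<sigma> \<in> signed_perms n"
      then have p: "\<sigma> permutes ?A" and odd: "\<And>i. \<sigma> (- i) = - \<sigma> i" by (auto simp: signed_perms_def)
      have inj: "inj_on (\<lambda>i. \<bar>\<sigma> (int i)\<bar>) {1..<Suc n}"
      proof (rule inj_onI)
        fix i j assume ij: "i \<in> {1..<Suc n}" "j \<in> {1..<Suc n}" "\<bar>\<sigma> (int i)\<bar> = \<bar>\<sigma> (int j)\<bar>"
        \<comment> \<open>Oddness turns equal absolute values into equal values at \<open>i\<close>
          and at \<open>j\<close> or \<open>- j\<close>; the negative case dies because both indices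
          are positive.\<close>
        then have "\<sigma> (int i) = \<sigma> (int j) \<or> \<sigma> (int i) = \<sigma> (- int j)" by (simp only: abs_eq_iff odd)
        then have "int i = int j \<or> int i = - int j" unfolding inj_eq[OF permutes_inj[OF p]] .
        then show "i = j" using ij by auto
      qed
      have "(\<lambda>i. \<bar>\<sigma> (int i)\<bar>) ` {1..<Suc n} = {1..int n}"
      proof (rule card_subset_eq)
        show "(\<lambda>i. \<bar>\<sigma> (int i)\<bar>) ` {1..<Suc n} \<subseteq> {1..int n}"
        proof (rule image_subsetI)
          fix i assume "i \<in> {1..<Suc n}"
          then have "\<sigma> (int i) \<in> ?A" using permutes_in_image[OF p, of "int i"] by auto
          then show "\<bar>\<sigma> (int i)\<bar> \<in> {1..int n}" by auto
        qed
        show "card ((\<lambda>i. \<bar>\<sigma> (int i)\<bar>) ` {1..<Suc n}) = card {1..int n}"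
          using card_image[OF inj] by simp
      qed simp
      moreover have "map abs (f \<sigma>) = map (\<lambda>i. \<bar>\<sigma> (int i)\<bar>) [1..<Suc n]"
        by (simp add: f_def del: upt_Suc)
      then have "distinct (map abs (f \<sigma>))"
        using inj by (simp add: distinct_map del: upt_Suc)
      ultimately show "f \<sigma> \<in> signed_words {1..int n}"
        by (simp add: signed_words_def f_def image_image del: upt_Suc)
    qed
    show "g ` signed_words {1..int n} \<subseteq> signed_perms n"
    proof (intro image_subsetI)
      fix w assume w: "w \<in> signed_words {1..int n}"
      then have l: "length w = n" using length_signed_word by fastforce
      have d: "distinct (map abs w)" and im: "abs ` set w = {1..int n}"
        using w by (auto simp: signed_words_def)
      have nth: "1 \<le> \<bar>w ! k\<bar> \<and> \<bar>w ! k\<bar> \<le> int n" if "k < n" for k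
        using im nth_mem[of k w] that l by (metis atLeastAtMost_iff image_eqI)
      have g_A: "\<bar>g w i\<bar> = \<bar>w ! (nat \<bar>i\<bar> - 1)\<bar>" "sgn (g w i) = sgn i * sgn (w ! (nat \<bar>i\<bar> - 1))"
        if "i \<in> ?A" for i
        using that by (auto simp: g_def abs_mult sgn_mult)
      \<comment> \<open>The absolute value of \<open>g w i\<close> determines the index in
        \<open>w\<close>, hence \<open>\<bar>i\<bar>\<close>; the sign of \<open>g w i\<close> then
        determines the sign of \<open>i\<close>. Surjectivity follows by finiteness.\<close>
      have "inj_on (g w) ?A"
      proof (rule inj_onI)
        fix i j assume ij: "i \<in> ?A" "j \<in> ?A" "g w i = g w j"
        have k: "nat \<bar>i\<bar> - 1 < n" "nat \<bar>j\<bar> - 1 < n" using ij by auto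
        have "\<bar>w ! (nat \<bar>i\<bar> - 1)\<bar> = \<bar>w ! (nat \<bar>j\<bar> - 1)\<bar>" using g_A(1) ij by metis
        then have "map abs w ! (nat \<bar>i\<bar> - 1) = map abs w ! (nat \<bar>j\<bar> - 1)" using k l by simp
        then have e: "nat \<bar>i\<bar> - 1 = nat \<bar>j\<bar> - 1"
          using d k l by (metis length_map nth_eq_iff_index_eq)
        then have "\<bar>i\<bar> = \<bar>j\<bar>" using ij by auto
        moreover have "sgn i = sgn j"
        proof -
          have "sgn i * sgn (w ! (nat \<bar>i\<bar> - 1)) = sgn j * sgn (w ! (nat \<bar>i\<bar> - 1))"
            using g_A(2)[OF ij(1)] g_A(2)[OF ij(2)] unfolding ij(3) e by metis
          moreover have "sgn (w ! (nat \<bar>i\<bar> - 1)) \<noteq> 0"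
            using nth[OF k(1)] unfolding sgn_0_0 by linarith
          ultimately show ?thesis by (metis mult_right_cancel)
        qed
        ultimately show "i = j" by (metis sgn_mult_abs)
      qed
      moreover have "g w ` ?A \<subseteq> ?A"
      proof (rule image_subsetI)
        fix i assume i: "i \<in> ?A"
        then have "nat \<bar>i\<bar> - 1 < n" by auto
        then have "1 \<le> \<bar>g w i\<bar> \<and> \<bar>g w i\<bar> \<le> int n" unfolding g_A(1)[OF i] by (rule nth)
        then show "g w i \<in> ?A" by auto
      qed
      ultimately have "bij_betw (g w) ?A ?A" by (simp add: bij_betw_def endo_inj_surj)
      then have "g w permutes ?A" by (rule bij_imp_permutes) (auto simp: g_def)
      moreover have "g w (- i) = - g w i" for i by (simp add: g_def sgn_if)
      ultimately show "g w \<in> signed_perms n" by (simp add: signed_perms_def)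
    qed
  qed
  then show ?thesis unfolding f_def .
qed

lemma prod_indicator_power:
  fixes x :: "'a::comm_monoid_mult"
  assumes "finite A"
  shows "(\<Prod>i\<in>A. if P i then x else 1) = x ^ card {i \<in> A. P i}"
  using assms by (simp add: prod.inter_filter[symmetric])

lemma Bhat_eq_words_poly: "Bhat n x y = words_poly x y n"
proof -
  have "x ^ des1 n \<sigma> * y ^ asc0 n \<sigma> = prefix_weight x y n (map (\<lambda>i. \<sigma> (int i)) [1..<Suc n])"
    if "\<sigma> \<in> signed_perms n" for \<sigma>
  proof -
    let ?d = "\<lambda>i. odd i \<and> \<sigma> (int i) > \<sigma> (int (i + 1))"
    let ?a = "\<lambda>i. even i \<and> \<sigma> (int i) < \<sigma> (int (i + 1))"
    have p: "\<sigma> permutes ({- int n..int n} - {0})" using that by (simp add: signed_perms_def)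
    have z: "\<sigma> 0 = 0" using permutes_not_in[OF p, of 0] by simp
    have sw: "step_weight x y (map (\<lambda>i. \<sigma> (int i)) [1..<Suc n]) i =
        (if ?d i then x else 1) * (if ?a i then y else 1)" if "i < n" for i
    proof -
      have "(0 # map (\<lambda>i. \<sigma> (int i)) [1..<Suc n]) ! i = \<sigma> (int i)"
        using that z by (cases i) (simp_all del: upt_Suc)
      moreover have "map (\<lambda>i. \<sigma> (int i)) [1..<Suc n] ! i = \<sigma> (int (i + 1))"
        using that by (simp del: upt_Suc)
      \<comment> \<open>Without ties, a position that is not an ascent is a descent, so the unmarked
        weight alone is the descent weight.\<close>
      moreover have "\<sigma> (int i) \<noteq> \<sigma> (int (i + 1))" using permutes_inj[OF p] by (auto dest: injD)
      ultimately show ?thesis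
        by (auto simp: step_weight_def unmarked_weight_def marked_weight_def simp del: upt_Suc)
    qed
    have "prefix_weight x y n (map (\<lambda>i. \<sigma> (int i)) [1..<Suc n]) =
        (\<Prod>i<n. (if ?d i then x else 1) * (if ?a i then y else 1))"
      unfolding prefix_weight_def by (intro prod.cong refl sw) simp
    also have "\<dots> = x ^ card {i \<in> {..<n}. ?d i} * y ^ card {i \<in> {..<n}. ?a i}"
      by (simp only: prod.distrib prod_indicator_power finite_lessThan)
    also have "{i \<in> {..<n}. ?d i} = {i \<in> descents n \<sigma>. odd i}" by (auto simp: descents_def)
    also have "{i \<in> {..<n}. ?a i} = {i \<in> ascents n \<sigma>. even i}" by (auto simp: ascents_def)
    finally show ?thesis by (simp add: des1_def asc0_def)
  qed
  then have "Bhat n x y = (\<Sum>\<sigma>\<in>signed_perms n. prefix_weight x y n (map (\<lambda>i. \<sigma> (int i)) [1..<Suc n]))"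
    by (simp add: Bhat_def del: upt_Suc)
  also have "\<dots> = words_poly x y n"
    using sum.reindex_bij_betw[OF bij_betw_signed_perms_signed_words, of "prefix_weight x y n" n]
    by (simp add: words_poly_def words_sum_def del: upt_Suc)
  finally show ?thesis .
qed

subsection \<open>Exponential generating functions\<close>

definition cosh_fps :: "'a \<Rightarrow> 'a \<Rightarrow> 'a::field_char_0 fps" where
  "cosh_fps c r = Abs_fps (\<lambda>m. if even m then c ^ (m div 2) * r ^ m / fact m else 0)"

text \<open>Dividing by the square root of \<open>c\<close> leaves only integral powers of
  \<open>c\<close>, so no root has to exist in the field.\<close>

definition sinh_fps :: "'a \<Rightarrow> 'a \<Rightarrow> 'a::field_char_0 fps" where
  "sinh_fps c r = Abs_fps (\<lambda>m. if odd m then c ^ (m div 2) * r ^ m / fact m else 0)"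

lemma fps_deriv_cosh_fps: "fps_deriv (cosh_fps c r) = fps_const (c * r) * sinh_fps c r"
proof (rule fps_ext)
  fix n
  have "of_nat (Suc n) * (z / fact (Suc n)) = z / fact n" for z :: 'a
    by (simp add: fact_Suc del: of_nat_Suc)
  then show "fps_deriv (cosh_fps c r) $ n = (fps_const (c * r) * sinh_fps c r) $ n"
    by (auto simp: cosh_fps_def sinh_fps_def simp del: of_nat_Suc fact_Suc elim!: oddE)
qed

lemma fps_deriv_sinh_fps: "fps_deriv (sinh_fps c r) = fps_const r * cosh_fps c r"
proof (rule fps_ext)
  fix n
  have "of_nat (Suc n) * (z / fact (Suc n)) = z / fact n" for z :: 'a
    by (simp add: fact_Suc del: of_nat_Suc)
  then show "fps_deriv (sinh_fps c r) $ n = (fps_const r * cosh_fps c r) $ n"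
    by (auto simp: cosh_fps_def sinh_fps_def simp del: of_nat_Suc fact_Suc elim!: evenE)
qed

text \<open>The derivative equations determine the coefficients at \<open>n + 1\<close> from those
  at \<open>n\<close>, as \<open>n + 1\<close> is invertible in characteristic zero.\<close>

lemma cosh_sinh_fps_unique:
  fixes c :: "'a::field_char_0"
  assumes "fps_deriv P = fps_const c * Q" "fps_deriv Q = P" "P $ 0 = 1" "Q $ 0 = 0"
  shows "P = cosh_fps c 1" "Q = sinh_fps c 1"
proof -
  have "P $ n = cosh_fps c 1 $ n \<and> Q $ n = sinh_fps c 1 $ n" for n
  proof (induction n)
    case 0
    then show ?case using assms(3,4) by (simp add: cosh_fps_def sinh_fps_def)
  next
    case (Suc n)
    have nz: "of_nat (Suc n) \<noteq> (0 :: 'a)" by (simp del: of_nat_Suc)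
    have "of_nat (Suc n) * P $ Suc n = of_nat (Suc n) * cosh_fps c 1 $ Suc n"
      using arg_cong[OF assms(1), of "\<lambda>f. f $ n"] arg_cong[OF fps_deriv_cosh_fps[of c 1], of "\<lambda>f. f $ n"] Suc
      by simp
    moreover have "of_nat (Suc n) * Q $ Suc n = of_nat (Suc n) * sinh_fps c 1 $ Suc n"
      using arg_cong[OF assms(2), of "\<lambda>f. f $ n"] arg_cong[OF fps_deriv_sinh_fps[of c 1], of "\<lambda>f. f $ n"] Suc
      by simp
    ultimately show ?case using nz by (simp del: of_nat_Suc)
  qed
  then show "P = cosh_fps c 1" "Q = sinh_fps c 1" by (auto intro: fps_ext)
qed

lemma cosh_fps_nth_0 [simp]: "cosh_fps c r $ 0 = 1"
  and sinh_fps_nth_0 [simp]: "sinh_fps c r $ 0 = 0"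
  by (simp_all add: cosh_fps_def sinh_fps_def)

text \<open>The derivative vanishes, so the series equals its constant term.\<close>

lemma cosh_fps_sinh_fps_square:
  "cosh_fps c r * cosh_fps c r - fps_const c * sinh_fps c r * sinh_fps c r = 1" (is "?f = 1")
proof -
  have "fps_deriv ?f = 0"
    by (simp add: fps_deriv_cosh_fps fps_deriv_sinh_fps algebra_simps flip: fps_const_mult)
  then have "?f = fps_const (?f $ 0)" by (rule iffD1[OF fps_deriv_eq_0_iff])
  then show ?thesis by simp
qed

text \<open>The subtraction formulas for arguments \<open>2\<close> and \<open>1\<close>: both
  left-hand sides satisfy the derivative system and the initial values that characterise the
  right-hand sides.\<close>

lemma cosh_sinh_fps_diff:
  fixes c :: "'a::field_char_0"
  shows "cosh_fps c 2 * cosh_fps c 1 - fps_const c * sinh_fps c 2 * sinh_fps c 1 = cosh_fps c 1" (is "?P = _")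
    and "sinh_fps c 2 * cosh_fps c 1 - cosh_fps c 2 * sinh_fps c 1 = sinh_fps c 1" (is "?Q = _")
proof -
  have two: "fps_const (2 :: 'a) = 1 + 1" by (metis fps_const_add fps_const_1_eq_1 one_add_one)
  have P: "fps_deriv ?P = fps_const c * ?Q"
    by (simp add: fps_deriv_cosh_fps fps_deriv_sinh_fps algebra_simps two flip: fps_const_mult)
  have Q: "fps_deriv ?Q = ?P"
    by (simp add: fps_deriv_cosh_fps fps_deriv_sinh_fps algebra_simps two flip: fps_const_mult)
  show "?P = cosh_fps c 1" "?Q = sinh_fps c 1"
    using cosh_sinh_fps_unique[OF P Q] by simp_all
qed

section \<open>From the recurrence to linear equations for the generating functions\<close>

text \<open>Marked weights alternate, and two neighbours multiply to \<open>c\<close>. For odd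
  \<open>d\<close> one factor is left over; it has the parity of \<open>s\<close>.\<close>

lemma prod_marked_weight:
  "(\<Prod>i=s..<s+d. marked_weight x y i) =
     (if even d then 1 else marked_weight x y s) * ((y - 1) * (1 - x)) ^ (d div 2)"
proof (induction d)
  case (Suc d)
  then show ?case
    by (cases "even d"; cases "even s") (auto simp: marked_weight_def mult_ac elim!: evenE oddE)
qed simp

lemma words_poly_div_fact_recurrence:
  fixes x y :: "'a::field_char_0"
  shows "words_poly x y n / fact n = (\<Prod>i<n. marked_weight x y i) / fact n +
    (\<Sum>j<n. unmarked_weight x j * (words_poly x y j / fact j) *
       (2 ^ (n - j) / fact (n - j) * (\<Prod>i=Suc j..<n. marked_weight x y i)))"
proof -
  have "unmarked_weight x j * (2 ^ (n - j) * of_nat (n choose j) * words_poly x y j) * p / fact n =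
      unmarked_weight x j * (words_poly x y j / fact j) * (2 ^ (n - j) / fact (n - j) * p)"
    if "j < n" for j p
    using that by (simp add: binomial_fact field_simps)
  then show ?thesis
    by (subst words_poly_recurrence) (simp add: add_divide_distrib sum_divide_distrib)
qed

text \<open>Includes the constant term \<open>1\<close> for the empty word, which the final identity
  leaves out.\<close>

definition even_egf :: "'a \<Rightarrow> 'a \<Rightarrow> 'a::field_char_0 fps" where
  "even_egf x y = Abs_fps (\<lambda>m. if even m then words_poly x y m / fact m else 0)"

definition odd_egf :: "'a \<Rightarrow> 'a \<Rightarrow> 'a::field_char_0 fps" where
  "odd_egf x y = Abs_fps (\<lambda>m. if odd m then words_poly x y m / fact m else 0)"

text \<open>The recurrence at even \<open>n\<close>, times \<open>y - 1\<close>. For odd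
  \<open>j\<close> the marked product is a pure power of \<open>c\<close> (a \<open>sinh\<close>
  coefficient); for even \<open>j\<close> it has a spare \<open>1 - x\<close>, which the factor
  \<open>y - 1\<close> completes to \<open>c\<close> (a \<open>cosh\<close> coefficient).\<close>

lemma even_egf_equation:
  fixes x y :: "'a::field_char_0"
  defines "c \<equiv> (y - 1) * (1 - x)"
  shows "fps_const (y - 1) * even_egf x y = fps_const (y - 1) * cosh_fps c 1 +
    even_egf x y * (cosh_fps c 2 - 1) + fps_const (y - 1) * fps_const x * odd_egf x y * sinh_fps c 2"
    (is "?L = ?R")
proof (rule fps_ext)
  fix n
  let ?t = "\<lambda>j. even_egf x y $ j * (cosh_fps c 2 - 1) $ (n - j) +
    (y - 1) * x * (odd_egf x y $ j * sinh_fps c 2 $ (n - j))"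
  have R: "?R $ n = (y - 1) * cosh_fps c 1 $ n + (\<Sum>j<n. ?t j)"
  proof -
    have "?R $ n = (y - 1) * cosh_fps c 1 $ n + (\<Sum>j=0..n. ?t j)"
      by (simp add: fps_mult_nth[of "even_egf x y"] fps_mult_nth[of "odd_egf x y"]
          mult.assoc sum.distrib sum_distrib_left)
    also have "(\<Sum>j=0..n. ?t j) = (\<Sum>j<n. ?t j) + ?t n"
      by (simp add: atLeast0AtMost lessThan_Suc_atMost[symmetric])
    \<comment> \<open>Neither \<open>cosh_fps c 2 - 1\<close> nor \<open>sinh_fps c 2\<close> has a
      constant term, so the convolution stops before \<open>n\<close>.\<close>
    also have "?t n = 0" by simp
    finally show ?thesis by simp
  qed
  show "?L $ n = ?R $ n"
  proof (cases "even n")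
    case False
    then have "?t j = 0" if "j < n" for j
      using that by (auto simp: even_egf_def odd_egf_def cosh_fps_def sinh_fps_def)
    then have "(\<Sum>j<n. ?t j) = 0" by simp
    then show ?thesis unfolding R using False by (simp add: even_egf_def cosh_fps_def)
  next
    case True
    have "?t j = (y - 1) * (unmarked_weight x j * (words_poly x y j / fact j) *
       (2 ^ (n - j) / fact (n - j) * (\<Prod>i=Suc j..<n. marked_weight x y i)))" if "j < n" for j
    proof -
      \<comment> \<open>\<open>d\<close> counts the marked positions after \<open>j\<close>.\<close>
      obtain d where d: "n = Suc j + d" using \<open>j < n\<close> less_iff_Suc_add by auto
      have nj: "n - j = Suc d" using d by simp
      have M: "(\<Prod>i=Suc j..<n. marked_weight x y i) =
          (if even d then 1 else marked_weight x y (Suc j)) * c ^ (d div 2)"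
        unfolding d c_def by (rule prod_marked_weight)
      show ?thesis
      proof (cases "even d")
        case True
        then have "odd j" "Suc d div 2 = d div 2" using \<open>even n\<close> d by auto
        with True show ?thesis unfolding M nj
          by (simp add: even_egf_def odd_egf_def cosh_fps_def sinh_fps_def unmarked_weight_def
              del: power_Suc fact_Suc)
      next
        case False
        then have "even j" "c ^ (Suc d div 2) = c * c ^ (d div 2)" using \<open>even n\<close> d by auto
        with False show ?thesis unfolding M nj
          by (simp add: even_egf_def odd_egf_def cosh_fps_def sinh_fps_def unmarked_weight_def
              marked_weight_def del: power_Suc fact_Suc) (simp add: c_def del: power_Suc fact_Suc)
      qed
    qed
    then have "(\<Sum>j<n. ?t j) = (y - 1) * (\<Sum>j<n. unmarked_weight x j * (words_poly x y j / fact j) *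
       (2 ^ (n - j) / fact (n - j) * (\<Prod>i=Suc j..<n. marked_weight x y i)))"
      by (simp add: sum_distrib_left)
    moreover have "(\<Prod>i<n. marked_weight x y i) / fact n = cosh_fps c 1 $ n"
      using True prod_marked_weight[of x y 0 n] by (simp add: cosh_fps_def c_def atLeast0LessThan)
    moreover have "even_egf x y $ n = words_poly x y n / fact n" using True by (simp add: even_egf_def)
    ultimately show ?thesis
      unfolding R by (simp add: words_poly_div_fact_recurrence[of x y n] distrib_left)
  qed
qed

text \<open>The recurrence at odd \<open>n\<close>, times \<open>1 - x\<close>: now the spare
  factor, for odd \<open>j\<close> and in the fully marked product, is \<open>y - 1\<close>.\<close>

lemma odd_egf_equation:
  fixes x y :: "'a::field_char_0"
  defines "c \<equiv> (y - 1) * (1 - x)"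
  shows "fps_const (1 - x) * odd_egf x y = fps_const c * sinh_fps c 1 +
    fps_const (1 - x) * even_egf x y * sinh_fps c 2 + fps_const x * odd_egf x y * (cosh_fps c 2 - 1)"
    (is "?L = ?R")
proof (rule fps_ext)
  fix n
  let ?t = "\<lambda>j. (1 - x) * (even_egf x y $ j * sinh_fps c 2 $ (n - j)) +
    x * (odd_egf x y $ j * (cosh_fps c 2 - 1) $ (n - j))"
  have R: "?R $ n = c * sinh_fps c 1 $ n + (\<Sum>j<n. ?t j)"
  proof -
    have "?R $ n = c * sinh_fps c 1 $ n + (\<Sum>j=0..n. ?t j)"
      by (simp add: fps_mult_nth[of "even_egf x y"] fps_mult_nth[of "odd_egf x y"]
          mult.assoc sum.distrib sum_distrib_left)
    also have "(\<Sum>j=0..n. ?t j) = (\<Sum>j<n. ?t j) + ?t n"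
      by (simp add: atLeast0AtMost lessThan_Suc_atMost[symmetric])
    also have "?t n = 0" by simp
    finally show ?thesis by simp
  qed
  show "?L $ n = ?R $ n"
  proof (cases "even n")
    case True
    then have "?t j = 0" if "j < n" for j
      using that by (auto simp: even_egf_def odd_egf_def cosh_fps_def sinh_fps_def)
    then have "(\<Sum>j<n. ?t j) = 0" by simp
    then show ?thesis unfolding R using True by (simp add: odd_egf_def sinh_fps_def)
  next
    case False
    have "?t j = (1 - x) * (unmarked_weight x j * (words_poly x y j / fact j) *
       (2 ^ (n - j) / fact (n - j) * (\<Prod>i=Suc j..<n. marked_weight x y i)))" if "j < n" for j
    proof -
      obtain d where d: "n = Suc j + d" using \<open>j < n\<close> less_iff_Suc_add by auto
      have nj: "n - j = Suc d" using d by simp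
      have M: "(\<Prod>i=Suc j..<n. marked_weight x y i) =
          (if even d then 1 else marked_weight x y (Suc j)) * c ^ (d div 2)"
        unfolding d c_def by (rule prod_marked_weight)
      show ?thesis
      proof (cases "even d")
        case True
        then have "even j" "Suc d div 2 = d div 2" using \<open>odd n\<close> d by auto
        with True show ?thesis unfolding M nj
          by (simp add: even_egf_def odd_egf_def cosh_fps_def sinh_fps_def unmarked_weight_def
              del: power_Suc fact_Suc)
      next
        case False
        then have "odd j" "c ^ (Suc d div 2) = c * c ^ (d div 2)" using \<open>odd n\<close> d by auto
        with False show ?thesis unfolding M nj
          by (simp add: even_egf_def odd_egf_def cosh_fps_def sinh_fps_def unmarked_weight_def
              marked_weight_def del: power_Suc fact_Suc) (simp add: c_def del: power_Suc fact_Suc)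
      qed
    qed
    then have "(\<Sum>j<n. ?t j) = (1 - x) * (\<Sum>j<n. unmarked_weight x j * (words_poly x y j / fact j) *
       (2 ^ (n - j) / fact (n - j) * (\<Prod>i=Suc j..<n. marked_weight x y i)))"
      by (simp add: sum_distrib_left)
    moreover have "(1 - x) * ((\<Prod>i<n. marked_weight x y i) / fact n) = c * sinh_fps c 1 $ n"
      using False prod_marked_weight[of x y 0 n]
      by (simp add: sinh_fps_def c_def atLeast0LessThan marked_weight_def)
    moreover have "odd_egf x y $ n = words_poly x y n / fact n" using False by (simp add: odd_egf_def)
    ultimately show ?thesis
      unfolding R by (simp add: words_poly_div_fact_recurrence[of x y n] distrib_left)
  qed
qed

section \<open>Solving the linear system\<close>

text \<open>Cramer's rule without division, so any commutative ring will do. \<open>C\<close>,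
  \<open>S\<close> stand for the series at \<open>2\<close> and \<open>h\<close>, \<open>s\<close>
  for those at \<open>1\<close>.\<close>

lemma solve_egf_system:
  fixes x y E O' C S h s :: "'a::comm_ring_1"
  assumes "(y - 1) * E = (y - 1) * h + E * (C - 1) + (y - 1) * x * O' * S"
    and "(1 - x) * O' = (y - 1) * (1 - x) * s + (1 - x) * E * S + x * O' * (C - 1)"
    and "C * C - (y - 1) * (1 - x) * S * S = 1"
    and "C * h - (y - 1) * (1 - x) * S * s = h"
    and "S * h - C * s = s"
  shows "E * ((x + y) - (1 + x * y) * C) = (y - 1) * (1 - x) * h"
    and "O' * ((x + y) - (1 + x * y) * C) = (1 + y) * ((y - 1) * (1 - x) * s)"
proof -
  let ?D = "(x + y) - (1 + x * y) * C"
  have E: "E * (y - C) = (y - 1) * (h + x * O' * S)"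
    using assms(1) by (simp add: algebra_simps)
  have O': "O' * (1 - x * C) = (1 - x) * ((y - 1) * s + E * S)"
    using assms(2) by (simp add: algebra_simps)
  \<comment> \<open>By the square identity the denominator is the determinant of the system
    \<open>E\<close>, \<open>O'\<close>.\<close>
  have "?D = (y - C) * (1 - x * C) - x * (C * C - 1)" by (simp add: algebra_simps)
  also have "C * C - 1 = (y - 1) * (1 - x) * S * S" using assms(3) by (simp add: algebra_simps)
  finally have D: "?D = (y - C) * (1 - x * C) - x * ((y - 1) * (1 - x) * S * S)" .
  have "E * ?D = (E * (y - C)) * (1 - x * C) - x * E * ((y - 1) * (1 - x) * S * S)"
    unfolding D by (simp add: algebra_simps)
  also have "\<dots> = (y - 1) * h * (1 - x * C) + (y - 1) * x * S * (O' * (1 - x * C))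
      - x * E * ((y - 1) * (1 - x) * S * S)"
    unfolding E by (simp add: algebra_simps)
  \<comment> \<open>The terms in \<open>E * S * S\<close> cancel, leaving the combination simplified
    by the subtraction formula.\<close>
  also have "\<dots> = (y - 1) * (h - x * (C * h - (y - 1) * (1 - x) * S * s))"
    unfolding O' by (simp add: algebra_simps)
  also have "\<dots> = (y - 1) * (1 - x) * h"
    unfolding assms(4) by (simp add: algebra_simps)
  finally show "E * ?D = (y - 1) * (1 - x) * h" .
  have "O' * ?D = (O' * (1 - x * C)) * (y - C) - x * O' * ((y - 1) * (1 - x) * S * S)"
    unfolding D by (simp add: algebra_simps)
  also have "\<dots> = (1 - x) * (y - 1) * s * (y - C) + (1 - x) * S * (E * (y - C))
      - x * O' * ((y - 1) * (1 - x) * S * S)"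
    unfolding O' by (simp add: algebra_simps)
  also have "\<dots> = (y - 1) * (1 - x) * (s * y + (S * h - C * s))"
    unfolding E by (simp add: algebra_simps)
  also have "\<dots> = (1 + y) * ((y - 1) * (1 - x) * s)"
    unfolding assms(5) by (simp add: algebra_simps)
  finally show "O' * ?D = (1 + y) * ((y - 1) * (1 - x) * s)" .
qed

lemma egf_closed_forms:
  fixes x y :: "'a::field_char_0"
  defines "c \<equiv> (y - 1) * (1 - x)"
  shows "even_egf x y * (fps_const (x + y) - fps_const (1 + x * y) * cosh_fps c 2) =
      fps_const c * cosh_fps c 1"
    and "odd_egf x y * (fps_const (x + y) - fps_const (1 + x * y) * cosh_fps c 2) =
      fps_const (1 + y) * (fps_const c * sinh_fps c 1)"
  using solve_egf_system[of "fps_const y" "even_egf x y" "cosh_fps c 1" "cosh_fps c 2" "fps_const x"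
      "odd_egf x y" "sinh_fps c 2" "sinh_fps c 1"]
    \<comment> \<open>In the even equation \<open>y\<close> occurs first, hence the order in
      \<open>of\<close>; both equations are used at the same \<open>x\<close> and
      \<open>y\<close>.\<close>
    even_egf_equation[of y x] odd_egf_equation[of x y] cosh_fps_sinh_fps_square[of c 2]
    cosh_sinh_fps_diff[of c]
  by (simp_all add: c_def flip: fps_const_mult fps_const_add fps_const_sub)

section \<open>Passage to the field of rational functions\<close>

text \<open>Gives \<open>ratfun\<close> characteristic zero, so that division by factorials is
  legitimate.\<close>

instance fract :: ("{idom,ring_char_0}") ring_char_0
  by standard (auto simp: inj_def of_nat_fract eq_fract)

lemma indet_x_neq_1: "indet_x \<noteq> 1"
proof -
  have "[:[:0, 1:]:] \<noteq> (1 :: int poly poly)" by (simp add: one_pCons)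
  then show ?thesis unfolding indet_x_def by (metis to_fract_1 to_fract_eq_iff)
qed

lemma indet_y_neq_1: "indet_y \<noteq> 1"
proof -
  have "[:0, 1:] \<noteq> (1 :: int poly poly)" by (simp add: one_pCons)
  then show ?thesis unfolding indet_y_def by (metis to_fract_1 to_fract_eq_iff)
qed

text \<open>The denominator has constant term \<open>- \<alpha>\<close>, nonzero by the assumptions,
  so the closed forms may be divided by it. Removing the constant term \<open>1\<close> of
  \<open>even_egf\<close> subtracts \<open>D\<close> from the numerator.\<close>

lemma Bhat_egf:
  fixes x y :: "'a::field_char_0"
  assumes "x \<noteq> 1" "y \<noteq> 1"
  defines "\<alpha> \<equiv> (1 - x) * (1 - y)"
  defines "D \<equiv> fps_const (x + y) - fps_const (1 + x * y) * cosh_fps (- \<alpha>) 2"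
  shows "Abs_fps (\<lambda>m. if even m \<and> m \<ge> 1 then Bhat m x y / fact m else 0) =
      (fps_const (1 + x * y) * cosh_fps (- \<alpha>) 2 + fps_const (- \<alpha>) * cosh_fps (- \<alpha>) 1
        - fps_const (x + y)) / D" (is "?E = ?N / D")
    and "Abs_fps (\<lambda>m. if odd m then Bhat m x y / fact m else 0) =
      (fps_const (1 + y) * (fps_const (- \<alpha>) * sinh_fps (- \<alpha>) 1)) / D" (is "?O = ?N' / D")
proof -
  have \<alpha>: "- \<alpha> = (y - 1) * (1 - x)" by (simp add: \<alpha>_def algebra_simps)
  have "D $ 0 = - \<alpha>" by (simp add: D_def \<alpha>_def algebra_simps)
  then have D: "D \<noteq> 0" using assms(1,2) by (auto simp: \<alpha>_def)
  have "words_poly x y 0 = 1" by (subst words_poly_recurrence) simp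
  then have "?E = even_egf x y - 1"
    by (intro fps_ext) (auto simp: even_egf_def Bhat_eq_words_poly)
  then have "?E * D = even_egf x y * D - D" by (simp add: left_diff_distrib)
  also have "\<dots> = ?N" using egf_closed_forms(1)[of x y] unfolding D_def \<alpha> by simp
  finally have "?E * D = ?N" .
  then show "?E = ?N / D" using nonzero_mult_div_cancel_right[OF D, of ?E] by (simp only:)
  have "?O = odd_egf x y" by (rule fps_ext) (simp add: odd_egf_def Bhat_eq_words_poly)
  then have "?O * D = ?N'" using egf_closed_forms(2)[of x y] unfolding D_def \<alpha> by simp
  then show "?O = ?N' / D" using nonzero_mult_div_cancel_right[OF D, of ?O] by (simp only:)
qed

theorem theorem1p3:
  shows "let x = indet_x; y = indet_y; \<alpha> = (1 - x) * (1 - y);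
             C2 = Abs_fps (\<lambda>m. if even m then (- \<alpha>) ^ (m div 2) * 2 ^ m / fact m else 0);
             C1 = Abs_fps (\<lambda>m. if even m then (- \<alpha>) ^ (m div 2 + 1) / fact m else 0);
             S1 = Abs_fps (\<lambda>m. if odd m then (- \<alpha>) ^ (m div 2 + 1) / fact m else 0)
         in
           Abs_fps (\<lambda>m. if even m \<and> m \<ge> 1 then Bhat m x y / fact m else 0) =
             (fps_const (1 + x * y) * C2 + C1 - fps_const (x + y)) /
             (fps_const (x + y) - fps_const (1 + x * y) * C2)
           \<and>
           Abs_fps (\<lambda>m. if odd m then Bhat m x y / fact m else 0) =
             (fps_const (1 + y) * S1) /
             (fps_const (x + y) - fps_const (1 + x * y) * C2)"
proof -
  let ?x = indet_x and ?y = indet_y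
  let ?c = "- ((1 - ?x) * (1 - ?y))"
  \<comment> \<open>The extra power in the numerator series is the constant factor
    \<open>- \<alpha>\<close>.\<close>
  have C1: "Abs_fps (\<lambda>m. if even m then ?c ^ (m div 2 + 1) / fact m else 0) = fps_const ?c * cosh_fps ?c 1"
    and S1: "Abs_fps (\<lambda>m. if odd m then ?c ^ (m div 2 + 1) / fact m else 0) = fps_const ?c * sinh_fps ?c 1"
    by (rule fps_ext, simp add: cosh_fps_def sinh_fps_def)+
  show ?thesis
    unfolding Let_def C1 S1 cosh_fps_def[of ?c 2, symmetric]
    using Bhat_egf[OF indet_x_neq_1 indet_y_neq_1] by blast
qed

end
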